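(* Let $G$ be a bridgeless cubic graph having a $2$-factor all of whose cycles are chordless cycles of length $5$. If the multigraph $G^*$ is bipartite, then $G$ has a Fulkerson covering.
   Context: $G^*$ denotes the multigraph obtained from $G$ by contracting each $5$-cycle of the given $2$-factor to a single vertex (the remaining edges, which form the perfect matching complementary to the $2$-factor, become the edges of $G^*$); $G^*$ is $5$-regular. A Fulkerson covering of $G$ is a family of $6$ perfect matchings of $G$ (not necessarily distinct) such that every edge of $G$ lies in exactly two of them. *)

theory Defs
  imports Main
begin

text \<open>Undirected multigraphs, loops and parallel edges allowed. The ends of an edge form a
  two-element set, or a singleton if the edge is a loop.\<close>

record ('v, 'e) multigraph =
  verts :: "'v set"
  edges :: "'e set"
  ends :: "'e \<Rightarrow> 'v set"

definition finite_multigraph :: "('v, 'e) multigraph \<Rightarrow> bool" where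
  "finite_multigraph G \<longleftrightarrow> finite (verts G) \<and> finite (edges G) \<and>
     (\<forall>e\<in>edges G. ends G e \<subseteq> verts G \<and> (card (ends G e) = 1 \<or> card (ends G e) = 2))"

text \<open>A loop counts twice.\<close>

definition degree :: "('v, 'e) multigraph \<Rightarrow> 'v \<Rightarrow> nat" where
  "degree G v = card {e \<in> edges G. v \<in> ends G e} + card {e \<in> edges G. ends G e = {v}}"

definition regular :: "nat \<Rightarrow> ('v, 'e) multigraph \<Rightarrow> bool" where
  "regular k G \<longleftrightarrow> (\<forall>v\<in>verts G. degree G v = k)"

abbreviation cubic :: "('v, 'e) multigraph \<Rightarrow> bool" where
  "cubic G \<equiv> regular 3 G"

definition adj :: "('v, 'e) multigraph \<Rightarrow> ('v \<times> 'v) set" where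
  "adj G = {(u, v). \<exists>e\<in>edges G. ends G e = {u, v}}"

text \<open>Connected components, represented by their vertex sets.\<close>

definition components :: "('v, 'e) multigraph \<Rightarrow> 'v set set" where
  "components G = {{v \<in> verts G. (u, v) \<in> (adj G)\<^sup>*} | u. u \<in> verts G}"

definition spanning_subgraph :: "('v, 'e) multigraph \<Rightarrow> 'e set \<Rightarrow> ('v, 'e) multigraph" where
  "spanning_subgraph G F = G\<lparr>edges := edges G \<inter> F\<rparr>"

definition induced_subgraph :: "('v, 'e) multigraph \<Rightarrow> 'v set \<Rightarrow> ('v, 'e) multigraph" where
  "induced_subgraph G X =
     G\<lparr>verts := verts G \<inter> X, edges := {e \<in> edges G. ends G e \<subseteq> X}\<rparr>"

definition bridge :: "('v, 'e) multigraph \<Rightarrow> 'e \<Rightarrow> bool" where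
  "bridge G e \<longleftrightarrow> e \<in> edges G \<and>
     card (components (spanning_subgraph G (edges G - {e}))) > card (components G)"

definition bridgeless :: "('v, 'e) multigraph \<Rightarrow> bool" where
  "bridgeless G \<longleftrightarrow> (\<forall>e\<in>edges G. \<not> bridge G e)"

definition is_cycle :: "nat \<Rightarrow> ('v, 'e) multigraph \<Rightarrow> bool" where
  "is_cycle n C \<longleftrightarrow> n > 0 \<and>
     (\<exists>x f. bij_betw x {..<n} (verts C) \<and> bij_betw f {..<n} (edges C) \<and>
        (\<forall>i<n. ends C (f i) = {x i, x (Suc i mod n)}))"

text \<open>An edge parallel to an edge of the cycle also counts as a chord.\<close>

definition chordless :: "('v, 'e) multigraph \<Rightarrow> ('v, 'e) multigraph \<Rightarrow> bool" where
  "chordless G C \<longleftrightarrow> (\<forall>e\<in>edges G. ends G e \<subseteq> verts C \<longrightarrow> e \<in> edges C)"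

definition two_factor :: "('v, 'e) multigraph \<Rightarrow> 'e set \<Rightarrow> bool" where
  "two_factor G F \<longleftrightarrow> F \<subseteq> edges G \<and> regular 2 (spanning_subgraph G F)"

definition factor_cycles :: "('v, 'e) multigraph \<Rightarrow> 'e set \<Rightarrow> ('v, 'e) multigraph set" where
  "factor_cycles G F =
     induced_subgraph (spanning_subgraph G F) ` components (spanning_subgraph G F)"

text \<open>The multigraph obtained by contracting every component of \<open>F\<close> to a single vertex,
  the new vertex being the vertex set of that component.\<close>

definition contract :: "('v, 'e) multigraph \<Rightarrow> 'e set \<Rightarrow> ('v set, 'e) multigraph" where
  "contract G F =
     \<lparr>verts = components (spanning_subgraph G F),
      edges = edges G - F,
      ends = (\<lambda>e. {X \<in> components (spanning_subgraph G F). X \<inter> ends G e \<noteq> {}})\<rparr>"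

definition bipartite :: "('v, 'e) multigraph \<Rightarrow> bool" where
  "bipartite G \<longleftrightarrow> (\<exists>A B. A \<inter> B = {} \<and> A \<union> B = verts G \<and>
     (\<forall>e\<in>edges G. \<exists>a\<in>A. \<exists>b\<in>B. ends G e = {a, b}))"

definition perfect_matching :: "('v, 'e) multigraph \<Rightarrow> 'e set \<Rightarrow> bool" where
  "perfect_matching G M \<longleftrightarrow> M \<subseteq> edges G \<and> (\<forall>e\<in>M. card (ends G e) = 2) \<and>
     (\<forall>v\<in>verts G. \<exists>!e. e \<in> M \<and> v \<in> ends G e)"

definition fulkerson_covering :: "('v, 'e) multigraph \<Rightarrow> (nat \<Rightarrow> 'e set) \<Rightarrow> bool" where
  "fulkerson_covering G M \<longleftrightarrow> (\<forall>i<6. perfect_matching G (M i)) \<and>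
     (\<forall>e\<in>edges G. card {i. i < 6 \<and> e \<in> M i} = 2)"

end

theory Submission
  imports Defs
begin

text \<open>The contracted multigraph \<open>G\<^sup>*\<close> is 5-regular and bipartite, so by Koenig's theorem its
  edges decompose into five perfect matchings; hence every pentagon sees each of the five colours
  on exactly one of its outgoing edges. For each colour, take the outgoing edges of that colour
  and complete them on every pentagon by the unique perfect matching of the remaining path on four
  vertices. Each outgoing edge is used once and, by the rotational symmetry of the pentagon, each
  pentagon edge twice. Adding the complement of the 2-factor as a sixth perfect matching covers
  every edge exactly twice.\<close>

section \<open>Edge colourings of regular bipartite multigraphs\<close>

text \<open>Hall's marriage theorem by the Halmos-Vaughan induction on \<open>card I\<close>. If
  every nonempty proper subfamily has surplus, any choice for one index can be removed safely;
  otherwise a tight subfamily \<open>J\<close> is matched inside its union, and the remaining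
  indices outside that union.\<close>

theorem hall:
  fixes A :: "'i \<Rightarrow> 'a set"
  assumes "finite I" and "\<And>i. i \<in> I \<Longrightarrow> finite (A i)"
    and "\<And>J. J \<subseteq> I \<Longrightarrow> card J \<le> card (\<Union>(A ` J))"
  shows "\<exists>f. inj_on f I \<and> (\<forall>i\<in>I. f i \<in> A i)"
  using assms
proof (induction "card I" arbitrary: I A rule: less_induct)
  case less
  note fin = \<open>finite I\<close> and finA = less.prems(2) and hall = less.prems(3)
  consider "I = {}" | "I \<noteq> {}" "\<forall>J. J \<subset> I \<and> J \<noteq> {} \<longrightarrow> card J < card (\<Union>(A ` J))"
    | J where "J \<subset> I" "J \<noteq> {}" "card J = card (\<Union>(A ` J))"
    using hall by (metis le_neq_implies_less psubset_imp_subset)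
  then show ?case
  proof cases
    case 1
    then show ?thesis by simp
  next
    case 2
    then obtain i where i: "i \<in> I" by blast
    have "card {i} \<le> card (\<Union>(A ` {i}))"
      using hall i by blast
    then obtain a where a: "a \<in> A i"
      by fastforce
    let ?A = "\<lambda>j. A j - {a}"
    \<comment> \<open>Deleting \<open>a\<close> costs each union at most one element, and the strict
      inequality absorbs this loss.\<close>
    have "card J \<le> card (\<Union>(?A ` J))" if J: "J \<subseteq> I - {i}" for J
    proof (cases "J = {}")
      case False
      moreover have "J \<subset> I" using J i by blast
      ultimately have "card J < card (\<Union>(A ` J))"
        using 2 by blast
      moreover have "\<Union>(?A ` J) = \<Union>(A ` J) - {a}" by blast
      ultimately show ?thesis
        using diff_card_le_card_Diff[of "{a}" "\<Union>(A ` J)"] by simp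
    qed simp
    moreover have "card (I - {i}) < card I"
      using i fin by (intro psubset_card_mono) auto
    ultimately obtain f where f: "inj_on f (I - {i})" "\<forall>j\<in>I - {i}. f j \<in> ?A j"
      using less.hyps[of "I - {i}" ?A] fin finA by (metis DiffD1 finite_Diff)
    have "inj_on (f(i := a)) I \<and> (\<forall>j\<in>I. (f(i := a)) j \<in> A j)"
      using f a by (auto simp: inj_on_def)
    then show ?thesis by blast
  next
    case 3
    let ?U = "\<Union>(A ` J)"
    let ?A = "\<lambda>j. A j - ?U"
    have finJ: "finite J" "J \<subseteq> I"
      using 3 fin finite_subset by auto
    have finU: "finite ?U"
      using finJ finA by blast
    have "card J < card I"
      using 3 fin psubset_card_mono by blast
    then obtain f where f: "inj_on f J" "\<forall>j\<in>J. f j \<in> A j"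
      using less.hyps[of J A] finJ finA hall by (metis subset_iff subset_trans)
    \<comment> \<open>Hall's condition survives the removal of \<open>?U\<close>: apply it to
      \<open>J \<union> K\<close> and cancel the equality that holds for the tight family
      \<open>J\<close>.\<close>
    have "card K \<le> card (\<Union>(?A ` K))" if K: "K \<subseteq> I - J" for K
    proof -
      have finK: "finite K"
        using K fin finite_subset by blast
      have finUK: "finite (\<Union>(?A ` K))"
        using K finK finA by blast
      have "card J + card K = card (J \<union> K)"
        using K finJ finK by (subst card_Un_disjoint) auto
      also have "\<dots> \<le> card (\<Union>(A ` (J \<union> K)))"
        using K finJ by (intro hall) auto
      also have "\<Union>(A ` (J \<union> K)) = ?U \<union> \<Union>(?A ` K)"
        by blast
      also have "card \<dots> = card ?U + card (\<Union>(?A ` K))"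
        using finU finUK by (subst card_Un_disjoint) auto
      finally show ?thesis
        using 3 by simp
    qed
    moreover have "card (I - J) < card I"
      using 3 by (intro psubset_card_mono fin) blast
    ultimately obtain g where g: "inj_on g (I - J)" "\<forall>j\<in>I - J. g j \<in> ?A j"
      using less.hyps[of "I - J" ?A] fin finA by (metis DiffD1 finite_Diff)
    have "f ` J \<inter> g ` (I - J) = {}" using f(2) g(2) by fastforce
    then have "inj_on (\<lambda>j. if j \<in> J then f j else g j) (J \<union> (I - J))"
      using f(1) g(1) by (auto simp: inj_on_def)
    moreover have "J \<union> (I - J) = I" using finJ by blast
    ultimately have "inj_on (\<lambda>j. if j \<in> J then f j else g j) I" by simp
    then show ?thesis
      using f g by (intro exI[of _ "\<lambda>j. if j \<in> J then f j else g j"]) auto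
  qed
qed

lemma card_fibres:
  assumes "finite E" "finite J" "\<forall>x\<in>J. card {e\<in>E. l e = x} = k"
  shows "card {e\<in>E. l e \<in> J} = k * card J"
proof -
  have "{e\<in>E. l e \<in> J} = (\<Union>x\<in>J. {e\<in>E. l e = x})" by blast
  also have "card \<dots> = (\<Sum>x\<in>J. card {e\<in>E. l e = x})"
    using assms by (intro card_UN_disjoint) auto
  finally show ?thesis
    using assms by simp
qed

text \<open>A bipartite multigraph is given by the end maps \<open>l\<close> and \<open>r\<close>,
  so parallel edges stay distinct. Hall's condition comes from double counting: the
  \<open>k * card J\<close> edges at \<open>J\<close> all end in the neighbourhood of
  \<open>J\<close>, which receives only \<open>k\<close> edges per vertex.\<close>

lemma regular_bipartite_perfect_matching:
  fixes l :: "'e \<Rightarrow> 'a" and r :: "'e \<Rightarrow> 'b"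
  assumes "finite E" "finite A" "finite B" "l ` E \<subseteq> A" "r ` E \<subseteq> B"
    and degl: "\<forall>x\<in>A. card {e\<in>E. l e = x} = k"
    and degr: "\<forall>y\<in>B. card {e\<in>E. r e = y} = k"
    and "k > 0"
  shows "\<exists>P\<subseteq>E. bij_betw l P A \<and> bij_betw r P B"
proof -
  let ?S = "\<lambda>x. r ` {e\<in>E. l e = x}"
  have "card J \<le> card (\<Union>(?S ` J))" if J: "J \<subseteq> A" for J
  proof -
    let ?N = "\<Union>(?S ` J)"
    have N: "?N \<subseteq> B" using assms by blast
    have finJ: "finite J" "finite ?N"
      using J N assms finite_subset by metis+
    have "k * card J = card {e\<in>E. l e \<in> J}"
      using assms finJ J by (intro card_fibres[symmetric]) auto
    also have "\<dots> \<le> card {e\<in>E. r e \<in> ?N}"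
      using assms by (intro card_mono) auto
    also have "\<dots> = k * card ?N"
      using assms finJ N by (intro card_fibres) auto
    finally show ?thesis using \<open>k > 0\<close> by simp
  qed
  then obtain g where g: "inj_on g A" "\<forall>x\<in>A. g x \<in> ?S x"
    using hall[of A ?S] assms by auto
  then have "\<forall>x\<in>A. \<exists>e. e \<in> E \<and> l e = x \<and> r e = g x" by fastforce
  \<comment> \<open>Hall's theorem selects only partner vertices; \<open>h\<close> picks one of the
    possibly parallel edges joining \<open>x\<close> to \<open>g x\<close>.\<close>
  then obtain h where h: "\<forall>x\<in>A. h x \<in> E \<and> l (h x) = x \<and> r (h x) = g x" by metis
  \<comment> \<open>Counting all edges from either side shows that both sides have equal size, so
    the injection \<open>g\<close> is onto \<open>B\<close>.\<close>
  have "k * card A = card {e\<in>E. l e \<in> A}"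
    using assms by (intro card_fibres[symmetric]) auto
  also have "{e\<in>E. l e \<in> A} = {e\<in>E. r e \<in> B}"
    using assms by blast
  also have "card \<dots> = k * card B"
    using assms by (intro card_fibres) auto
  finally have "card A = card B"
    using \<open>k > 0\<close> by simp
  moreover have "g ` A \<subseteq> B"
    using g assms by blast
  ultimately have "g ` A = B"
    using g(1) \<open>finite B\<close> by (simp add: card_image card_subset_eq)
  then have "bij_betw r (h ` A) B"
    using h g(1) by (auto simp: bij_betw_def inj_on_def image_iff)
  moreover have "bij_betw l (h ` A) A"
    using h by (auto simp: bij_betw_def inj_on_def image_iff)
  ultimately show ?thesis
    using h by blast
qed

lemma card_fibre_minus_section:
  assumes "finite E" "P \<subseteq> E" "bij_betw l P A" "x \<in> A" "card {e\<in>E. l e = x} = Suc k"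
  shows "card {e\<in>E - P. l e = x} = k"
proof -
  obtain p where p: "p \<in> P" "l p = x"
    using assms by (metis bij_betw_imp_surj_on imageE)
  have "{e\<in>E - P. l e = x} = {e\<in>E. l e = x} - {p}"
    using p assms by (auto simp: bij_betw_def inj_on_def)
  then show ?thesis
    using assms p by (simp add: subset_iff)
qed

text \<open>Koenig's edge colouring theorem for the regular case: peel off a perfect matching
  \<open>P\<close>, give it the new colour \<open>k\<close>, and colour the \<open>k\<close>-regular
  remainder inductively.\<close>

theorem regular_bipartite_edge_colouring:
  fixes l :: "'e \<Rightarrow> 'a" and r :: "'e \<Rightarrow> 'b"
  assumes "finite E" "finite A" "finite B" "l ` E \<subseteq> A" "r ` E \<subseteq> B"
    and "\<forall>x\<in>A. card {e\<in>E. l e = x} = k"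
    and "\<forall>y\<in>B. card {e\<in>E. r e = y} = k"
  shows "\<exists>c::'e \<Rightarrow> nat. c ` E \<subseteq> {..<k} \<and>
    (\<forall>e\<in>E. \<forall>e'\<in>E. c e = c e' \<and> (l e = l e' \<or> r e = r e') \<longrightarrow> e = e')"
  using assms
proof (induction k arbitrary: E)
  case 0
  have "E = {}"
  proof (rule ccontr)
    assume "E \<noteq> {}"
    then obtain e where "e \<in> E" by blast
    then have "card {e'\<in>E. l e' = l e} = 0" using 0 by blast
    then show False using \<open>e \<in> E\<close> 0 by auto
  qed
  then show ?case by simp
next
  case (Suc k)
  obtain P where P: "P \<subseteq> E" "bij_betw l P A" "bij_betw r P B"
    using regular_bipartite_perfect_matching[OF Suc.prems] by auto
  have deg: "\<forall>x\<in>A. card {e\<in>E - P. l e = x} = k" "\<forall>y\<in>B. card {e\<in>E - P. r e = y} = k"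
    using Suc.prems(6,7) card_fibre_minus_section[OF Suc.prems(1) P(1,2)]
      card_fibre_minus_section[OF Suc.prems(1) P(1,3)] by blast+
  have "finite (E - P)" "l ` (E - P) \<subseteq> A" "r ` (E - P) \<subseteq> B"
    using Suc.prems by auto
  from Suc.IH[OF this(1) Suc.prems(2,3) this(2,3) deg]
  obtain c :: "'e \<Rightarrow> nat" where c: "c ` (E - P) \<subseteq> {..<k}"
    "\<forall>e\<in>E-P. \<forall>e'\<in>E-P. c e = c e' \<and> (l e = l e' \<or> r e = r e') \<longrightarrow> e = e'"
    by blast
  let ?c = "\<lambda>e. if e \<in> P then k else c e"
  have "?c ` E \<subseteq> {..<Suc k}"
    using c(1) by (auto simp: image_subset_iff less_Suc_eq)
  moreover have "e = e'"
    if "e \<in> E" "e' \<in> E" "?c e = ?c e'" "l e = l e' \<or> r e = r e'" for e e'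
  proof (cases "e \<in> P"; cases "e' \<in> P")
    assume "e \<in> P" "e' \<in> P"
    then show ?thesis using P that(4) by (auto simp: bij_betw_def inj_on_def)
  next
    assume "e \<notin> P" "e' \<notin> P"
    then show ?thesis using c(2) that by auto
  \<comment> \<open>An edge of \<open>P\<close> has colour \<open>k\<close>, an edge outside has a
    colour below \<open>k\<close>, so the mixed cases cannot arise.\<close>
  qed (use c(1) that in \<open>force simp: image_subset_iff\<close>)+
  ultimately show ?case by blast
qed

section \<open>The components of a 2-factor\<close>

lemma adj_sym: "(u, v) \<in> adj G \<Longrightarrow> (v, u) \<in> adj G"
  by (auto simp: adj_def insert_commute)

lemma adj_rtrancl_sym: "(u, v) \<in> (adj G)\<^sup>* \<Longrightarrow> (v, u) \<in> (adj G)\<^sup>*"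
  by (induction rule: rtrancl_induct) (auto intro: adj_sym converse_rtrancl_into_rtrancl)

lemma components_disjoint:
  assumes "X \<in> components G" "Y \<in> components G" "v \<in> X" "v \<in> Y"
  shows "X = Y"
proof -
  obtain a b where "X = {w \<in> verts G. (a, w) \<in> (adj G)\<^sup>*}" "Y = {w \<in> verts G. (b, w) \<in> (adj G)\<^sup>*}"
    using assms by (auto simp: components_def)
  with assms(3,4) show ?thesis
    by (auto; meson adj_rtrancl_sym rtrancl_trans)
qed

lemma components_subset: "X \<in> components G \<Longrightarrow> X \<subseteq> verts G"
  by (auto simp: components_def)

lemma ex_component: "v \<in> verts G \<Longrightarrow> \<exists>X\<in>components G. v \<in> X"
  by (auto simp: components_def)

text \<open>The ends of an edge are equal or one adjacency step apart, so an edge never leaves a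
  component that it meets.\<close>

lemma component_edge:
  assumes "finite_multigraph G" "X \<in> components G" "e \<in> edges G" "v \<in> ends G e" "v \<in> X"
  shows "ends G e \<subseteq> X"
proof
  fix w assume w: "w \<in> ends G e"
  have e: "ends G e \<subseteq> verts G" "card (ends G e) = 1 \<or> card (ends G e) = 2"
    using assms by (auto simp: finite_multigraph_def)
  then have "ends G e = {v, w} \<or> v = w"
    using w assms(4) by (auto simp: card_1_singleton_iff card_2_iff)
  then have "(v, w) \<in> (adj G)\<^sup>*"
    using assms(3) by (auto simp: adj_def)
  then show "w \<in> X"
    using assms w e by (auto simp: components_def)
qed

lemma spanning_subgraph_simps [simp]:
  "verts (spanning_subgraph G F) = verts G"
  "edges (spanning_subgraph G F) = edges G \<inter> F"
  "ends (spanning_subgraph G F) = ends G"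
  by (simp_all add: spanning_subgraph_def)

lemma finite_spanning_subgraph:
  "finite_multigraph G \<Longrightarrow> finite_multigraph (spanning_subgraph G F)"
  by (auto simp: finite_multigraph_def)

text \<open>\<open>F\<close> uses two of the three degrees at \<open>v\<close>. A loop is counted in
  both summands of \<open>degree\<close>, so the remaining one comes from a single edge that is not
  a loop.\<close>

lemma ex1_edge_outside_two_factor:
  assumes "finite_multigraph G" "cubic G" "two_factor G F" "v \<in> verts G"
  shows "\<exists>!e. e \<in> edges G - F \<and> v \<in> ends G e"
proof -
  let ?I = "{e \<in> edges G. v \<in> ends G e}" and ?L = "{e \<in> edges G. ends G e = {v}}"
  have fin: "finite (edges G)" using assms by (auto simp: finite_multigraph_def)
  have "card ?I + card ?L = 3"
    using assms by (auto simp: regular_def degree_def)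
  moreover have "card (?I \<inter> F) + card (?L \<inter> F) = 2"
  proof -
    have "?I \<inter> F = {e \<in> edges G \<inter> F. v \<in> ends G e}" "?L \<inter> F = {e \<in> edges G \<inter> F. ends G e = {v}}"
      by auto
    then show ?thesis
      using assms by (auto simp: two_factor_def regular_def degree_def)
  qed
  moreover have "card ?I = card (?I \<inter> F) + card (?I - F)" "card ?L = card (?L \<inter> F) + card (?L - F)"
    using fin by (simp_all add: card_Int_Diff)
  moreover have "card (?L - F) \<le> card (?I - F)"
    using fin by (intro card_mono) auto
  ultimately have "card (?I - F) = 1" by linarith
  then obtain e where "?I - F = {e}"
    by (auto simp: card_1_singleton_iff)
  then show ?thesis by (intro ex1I[of _ e]) auto
qed

section \<open>Perfect matchings of a pentagon minus a vertex\<close>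

text \<open>For an edge of a pentagon, these are the two vertices whose deletion leaves a path on four
  vertices having the edge in its perfect matching.\<close>

definition flanking :: "('v, 'e) multigraph \<Rightarrow> 'e set \<Rightarrow> 'e \<Rightarrow> 'v set" where
  "flanking G F e = {v. v \<notin> ends G e \<and> (\<exists>e'\<in>F. v \<in> ends G e' \<and> ends G e' \<inter> ends G e \<noteq> {})}"

lemma lessThan_5: "{..<5::nat} = {0, 1, 2, 3, 4}"
  by auto

text \<open>Naming the five vertices and edges turns statements about a pentagon into finite case
  checks. The edges are described as those of \<open>F\<close> meeting \<open>X\<close>, the form in
  which they are encountered at a vertex.\<close>

lemma pentagon_component:
  assumes "finite_multigraph G" "two_factor G F" "X \<in> components (spanning_subgraph G F)"
    and "is_cycle 5 (induced_subgraph (spanning_subgraph G F) X)"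
  obtains x0 x1 x2 x3 x4 f0 f1 f2 f3 f4 where
    "X = {x0, x1, x2, x3, x4}" "distinct [x0, x1, x2, x3, x4]"
    "{e\<in>F. ends G e \<inter> X \<noteq> {}} = {f0, f1, f2, f3, f4}"
    "ends G f0 = {x0, x1}" "ends G f1 = {x1, x2}" "ends G f2 = {x2, x3}"
    "ends G f3 = {x3, x4}" "ends G f4 = {x4, x0}"
proof -
  let ?C = "induced_subgraph (spanning_subgraph G F) X"
  have FG: "F \<subseteq> edges G" using assms by (simp add: two_factor_def)
  have V: "verts ?C = X"
    using components_subset[OF assms(3)] by (auto simp: induced_subgraph_def)
  \<comment> \<open>Nonempty end sets make an edge inside \<open>X\<close> also meet
    \<open>X\<close>; the converse is \<open>component_edge\<close>.\<close>
  have "ends G e \<noteq> {}" if "e \<in> F" for e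
    using that FG assms(1) by (force simp: finite_multigraph_def)
  then have E: "edges ?C = {e\<in>F. ends G e \<inter> X \<noteq> {}}"
    using component_edge[OF finite_spanning_subgraph[OF assms(1)] assms(3)] FG
    by (simp add: induced_subgraph_def) blast
  obtain x f where x: "bij_betw x {..<5} X" and f: "bij_betw f {..<5} {e\<in>F. ends G e \<inter> X \<noteq> {}}"
    and xf: "\<forall>i<5. ends G (f i) = {x i, x (Suc i mod 5)}"
    using assms(4) unfolding is_cycle_def V E by (auto simp: induced_subgraph_def)
  show thesis
  proof (rule that[of "x 0" "x 1" "x 2" "x 3" "x 4" "f 0" "f 1" "f 2" "f 3" "f 4"])
    show "X = {x 0, x 1, x 2, x 3, x 4}" "distinct [x 0, x 1, x 2, x 3, x 4]"
      using x unfolding bij_betw_def lessThan_5 by auto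
    show "{e\<in>F. ends G e \<inter> X \<noteq> {}} = {f 0, f 1, f 2, f 3, f 4}"
      using f unfolding bij_betw_def lessThan_5 by auto
    have "Suc 0 mod 5 = 1" "Suc 1 mod 5 = 2" "Suc 2 mod 5 = 3" "Suc 3 mod 5 = 4" "Suc 4 mod 5 = 0"
      by simp_all
    then show "ends G (f 0) = {x 0, x 1}" "ends G (f 1) = {x 1, x 2}" "ends G (f 2) = {x 2, x 3}"
      "ends G (f 3) = {x 3, x 4}" "ends G (f 4) = {x 4, x 0}"
      using xf[THEN spec, of 0] xf[THEN spec, of 1] xf[THEN spec, of 2] xf[THEN spec, of 3]
        xf[THEN spec, of 4] by (simp_all only:)
  qed
qed

text \<open>The edges flanked by \<open>v\<close> form the perfect matching of the pentagon without
  \<open>v\<close>; \<open>ex1_flanked_edge\<close> says that they cover every other vertex once.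
  That each edge is flanked by two vertices is the reason why pentagon edges get covered
  twice.\<close>

lemma pentagon_flanking:
  assumes "finite_multigraph G" "two_factor G F" "X \<in> components (spanning_subgraph G F)"
    and "is_cycle 5 (induced_subgraph (spanning_subgraph G F) X)"
  shows card_pentagon: "card X = 5"
    and card_ends_pentagon: "\<And>e. e \<in> F \<Longrightarrow> ends G e \<inter> X \<noteq> {} \<Longrightarrow> card (ends G e) = 2"
    and flanking_pentagon: "\<And>e. e \<in> F \<Longrightarrow> ends G e \<inter> X \<noteq> {} \<Longrightarrow>
      flanking G F e \<subseteq> X \<and> card (flanking G F e) = 2"
    and ex1_flanked_edge: "\<And>v w. v \<in> X \<Longrightarrow> w \<in> X \<Longrightarrow> v \<noteq> w \<Longrightarrow>
      \<exists>!e. e \<in> F \<and> w \<in> ends G e \<and> v \<in> flanking G F e"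
proof -
  obtain x0 x1 x2 x3 x4 f0 f1 f2 f3 f4 where
    X: "X = {x0, x1, x2, x3, x4}" and d: "distinct [x0, x1, x2, x3, x4]"
    and F: "{e\<in>F. ends G e \<inter> X \<noteq> {}} = {f0, f1, f2, f3, f4}"
    and ends: "ends G f0 = {x0, x1}" "ends G f1 = {x1, x2}" "ends G f2 = {x2, x3}"
      "ends G f3 = {x3, x4}" "ends G f4 = {x4, x0}"
    using pentagon_component[OF assms] .
  have F': "e \<in> F \<and> ends G e \<inter> X \<noteq> {} \<longleftrightarrow> e \<in> {f0, f1, f2, f3, f4}" for e
    using F by blast
  \<comment> \<open>An edge of \<open>F\<close> touching a pentagon edge meets \<open>X\<close>, so
    only the five listed edges need to be searched.\<close>
  have fl: "flanking G F e =
      {v. v \<notin> ends G e \<and> (\<exists>e'\<in>{f0, f1, f2, f3, f4}. v \<in> ends G e' \<and> ends G e' \<inter> ends G e \<noteq> {})}"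
    if "e \<in> {f0, f1, f2, f3, f4}" for e
  proof -
    have "ends G e \<subseteq> X" using that ends X by auto
    then show ?thesis unfolding flanking_def using F' by blast
  qed
  \<comment> \<open>With indices modulo 5, the edge from \<open>xj\<close> to \<open>x(j+1)\<close>
    is flanked by \<open>x(j-1)\<close> and \<open>x(j+2)\<close>.\<close>
  have "flanking G F f0 = {x2, x4}" "flanking G F f1 = {x3, x0}" "flanking G F f2 = {x4, x1}"
    "flanking G F f3 = {x0, x2}" "flanking G F f4 = {x1, x3}"
    using d by (simp_all add: fl ends) auto
  note fl5 = this
  show "card X = 5" using d X by simp
  show "card (ends G e) = 2" if "e \<in> F" "ends G e \<inter> X \<noteq> {}" for e
    using F'[of e] that ends d by auto
  show "flanking G F e \<subseteq> X \<and> card (flanking G F e) = 2" if "e \<in> F" "ends G e \<inter> X \<noteq> {}" for e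
    using F'[of e] that fl5 d X by auto
  show "\<exists>!e. e \<in> F \<and> w \<in> ends G e \<and> v \<in> flanking G F e" if "v \<in> X" "w \<in> X" "v \<noteq> w" for v w
  proof -
    have "(e \<in> F \<and> w \<in> ends G e \<and> v \<in> flanking G F e) \<longleftrightarrow>
      (e \<in> {f0, f1, f2, f3, f4} \<and> w \<in> ends G e \<and> v \<in> flanking G F e)" for e
      using F'[of e] that(2) by blast
    moreover have "\<exists>!e. e \<in> {f0, f1, f2, f3, f4} \<and> w \<in> ends G e \<and> v \<in> flanking G F e"
    proof (rule ex_ex1I)
      have "\<exists>e\<in>{f0, f1, f2, f3, f4}. w \<in> ends G e \<and> v \<in> flanking G F e"
        using that by (simp add: X ends fl5) blast
      then show "\<exists>e. e \<in> {f0, f1, f2, f3, f4} \<and> w \<in> ends G e \<and> v \<in> flanking G F e"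
        by (simp only: Bex_def)
      fix e e'
      assume e: "e \<in> {f0, f1, f2, f3, f4} \<and> w \<in> ends G e \<and> v \<in> flanking G F e"
        and e': "e' \<in> {f0, f1, f2, f3, f4} \<and> w \<in> ends G e' \<and> v \<in> flanking G F e'"
      have v: "v = x0 \<or> v = x1 \<or> v = x2 \<or> v = x3 \<or> v = x4"
        using that(1) by (simp add: X)
      have w: "w = x0 \<or> w = x1 \<or> w = x2 \<or> w = x3 \<or> w = x4"
        using that(2) by (simp add: X)
      \<comment> \<open>\<open>?P\<close> tabulates the pairs \<open>(w, v)\<close> served by each
        edge. The five edges account for 5 * 4 = 20 pairs, exactly the ordered pairs of distinct
        vertices, so no pair is served twice.\<close>
      have Pe: "(e = f0 \<and> (w = x0 \<or> w = x1) \<and> (v = x2 \<or> v = x4)) \<or>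
          (e = f1 \<and> (w = x1 \<or> w = x2) \<and> (v = x3 \<or> v = x0)) \<or>
          (e = f2 \<and> (w = x2 \<or> w = x3) \<and> (v = x4 \<or> v = x1)) \<or>
          (e = f3 \<and> (w = x3 \<or> w = x4) \<and> (v = x0 \<or> v = x2)) \<or>
          (e = f4 \<and> (w = x4 \<or> w = x0) \<and> (v = x1 \<or> v = x3))" (is "?P e")
        using e by (elim conjE insertE emptyE) (simp_all add: ends fl5)
      have Pe': "?P e'"
        using e' by (elim conjE insertE emptyE) (simp_all add: ends fl5)
      \<comment> \<open>The reversed list supplies every disequality in the opposite orientation for
        rewriting.\<close>
      show "e = e'"
        using v w by (elim disjE; use d distinct_rev[THEN iffD2, OF d] Pe Pe' in simp)
    qed
    ultimately show ?thesis by simp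
  qed
qed

section \<open>The covering\<close>

theorem theorem5p2:
  fixes G :: "('v, 'e) multigraph" and F :: "'e set"
  assumes "finite_multigraph G"
    and "cubic G"
    and "bridgeless G"
    and "two_factor G F"
    and "\<forall>C\<in>factor_cycles G F. is_cycle 5 C \<and> chordless G C"
    and "bipartite (contract G F)"
  shows "\<exists>M. fulkerson_covering G M"
proof -

  \<comment> \<open>The pentagons as components of the 2-factor\<close>
  let ?K = "components (spanning_subgraph G F)"
  let ?E = "edges G - F"
  have FG: "F \<subseteq> edges G" using assms(4) by (simp add: two_factor_def)
  have fin: "finite (verts G)" "finite ?E" using assms(1) by (auto simp: finite_multigraph_def)
  have ends_G: "ends G e \<subseteq> verts G" "ends G e \<noteq> {}" if "e \<in> edges G" for e
    using that assms(1) by (force simp: finite_multigraph_def)+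
  have cyc: "is_cycle 5 (induced_subgraph (spanning_subgraph G F) X)" if "X \<in> ?K" for X
    using assms(5) that by (auto simp: factor_cycles_def)
  note pent = pentagon_flanking[OF assms(1,4) _ cyc]
  have KV: "X \<subseteq> verts G" if "X \<in> ?K" for X
    using components_subset[OF that] by simp
  then have "finite ?K"
    using fin by (auto intro: finite_subset[of _ "Pow (verts G)"])
  have comp: "\<exists>X\<in>?K. v \<in> X" if "v \<in> verts G" for v
    using ex_component[of v "spanning_subgraph G F"] that by simp
  have F_meets: "\<exists>X\<in>?K. ends G e \<inter> X \<noteq> {}" if "e \<in> F" for e
  proof -
    have "e \<in> edges G" using that FG by blast
    then obtain v where "v \<in> ends G e" "v \<in> verts G" using ends_G[of e] by blast
    then show ?thesis using comp[of v] by blast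
  qed

  \<comment> \<open>The matching edge \<open>m v\<close> at each vertex\<close>
  define m where "m v = (THE e. e \<in> ?E \<and> v \<in> ends G e)" for v
  have m: "m v \<in> ?E \<and> v \<in> ends G (m v)" if "v \<in> verts G" for v
    unfolding m_def by (rule theI') (rule ex1_edge_outside_two_factor[OF assms(1,2,4) that])
  have m_unique: "e = m v" if "v \<in> verts G" "e \<in> ?E" "v \<in> ends G e" for e v
    using ex1_edge_outside_two_factor[OF assms(1,2,4) that(1)] m[OF that(1)] that(2,3) by blast

  \<comment> \<open>The bipartition of the contracted multigraph\<close>
  obtain A B where AB: "A \<inter> B = {}" "A \<union> B = ?K"
    and ab: "\<forall>e\<in>?E. \<exists>a\<in>A. \<exists>b\<in>B. {X \<in> ?K. X \<inter> ends G e \<noteq> {}} = {a, b}"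
    using assms(6) unfolding bipartite_def contract_def multigraph.select_convs
    by (elim exE conjE) (rule that)
  from ab have "\<forall>e\<in>?E. \<exists>a b. a \<in> A \<and> b \<in> B \<and> {X \<in> ?K. X \<inter> ends G e \<noteq> {}} = {a, b}"
    by (simp only: Bex_def ex_simps)
  \<comment> \<open>Ordering the two ends of a contracted edge by side puts the contracted
    multigraph into the form with end maps used for edge colouring.\<close>
  then obtain l r where lr: "\<forall>e\<in>?E. l e \<in> A \<and> r e \<in> B \<and>
      {X \<in> ?K. X \<inter> ends G e \<noteq> {}} = {l e, r e}"
    unfolding bchoice_iff by (elim exE) (rule that)
  have ends_iff: "X \<in> ?K \<and> X \<inter> ends G e \<noteq> {} \<longleftrightarrow> X = l e \<or> X = r e" if "e \<in> ?E" for e X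
  proof -
    have "X \<in> {X \<in> ?K. X \<inter> ends G e \<noteq> {}} \<longleftrightarrow> X \<in> {l e, r e}"
      using lr[THEN bspec, OF that] by simp
    then show ?thesis by simp
  qed
  have lA: "l e \<in> A" and rB: "r e \<in> B" if "e \<in> ?E" for e
    using lr[THEN bspec, OF that] by simp_all
  have lr_distinct: "l e \<noteq> r e" if "e \<in> ?E" for e
    using lA[OF that] rB[OF that] AB(1) by auto
  have l_iff: "l e = X \<longleftrightarrow> X \<inter> ends G e \<noteq> {}" if "e \<in> ?E" "X \<in> A" for e X
  proof -
    have "X \<in> ?K" using that AB by blast
    moreover have "r e \<noteq> X" using rB[OF that(1)] that(2) AB(1) by auto
    ultimately show ?thesis using ends_iff[OF that(1), of X] by auto
  qed
  have r_iff: "r e = X \<longleftrightarrow> X \<inter> ends G e \<noteq> {}" if "e \<in> ?E" "X \<in> B" for e X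
  proof -
    have "X \<in> ?K" using that AB by blast
    moreover have "l e \<noteq> X" using lA[OF that(1)] that(2) AB(1) by auto
    ultimately show ?thesis using ends_iff[OF that(1), of X] by auto
  qed

  \<comment> \<open>Five edges leave every pentagon\<close>
  have two_ends: "card (ends G e) = 2" if e: "e \<in> ?E" for e
  proof -
    have K: "l e \<in> ?K" "r e \<in> ?K" and "l e \<inter> ends G e \<noteq> {}" "r e \<inter> ends G e \<noteq> {}"
      using ends_iff[OF e] by blast+
    then obtain u v where uv: "u \<in> l e" "u \<in> ends G e" "v \<in> r e" "v \<in> ends G e"
      by blast
    \<comment> \<open>The edge meets two different pentagons, which are disjoint, so it cannot be a
      loop.\<close>
    have "u \<noteq> v" using uv K lr_distinct[OF e] components_disjoint by metis
    then have "card (ends G e) \<noteq> 1" using uv by (auto simp: card_1_singleton_iff)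
    then show ?thesis using assms(1) e by (auto simp: finite_multigraph_def)
  qed
  \<comment> \<open>An edge with both ends in one pentagon would become a loop after contraction,
    which bipartiteness excludes.\<close>
  have one_end: "u = v" if "e \<in> ?E" "X \<in> ?K" "u \<in> X" "v \<in> X" "u \<in> ends G e" "v \<in> ends G e"
    for e X u v
  proof (rule ccontr)
    assume "u \<noteq> v"
    have "ends G e = {u, v}"
      using two_ends[OF that(1)] \<open>u \<noteq> v\<close> that(5,6) by (auto simp: card_2_iff)
    moreover have "Y = X" if "Y \<in> ?K" "Y \<inter> {u, v} \<noteq> {}" for Y
      using components_disjoint[OF that(1) \<open>X \<in> ?K\<close>] that(2) \<open>u \<in> X\<close> \<open>v \<in> X\<close> by blast
    ultimately show False
      using ends_iff[OF that(1)] lr_distinct[OF that(1)] by metis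
  qed
  \<comment> \<open>Sending each vertex to its matching edge counts the edges leaving
    \<open>X\<close> by the vertices of \<open>X\<close>; this gives 5-regularity.\<close>
  have m_bij: "bij_betw m X {e\<in>?E. X \<inter> ends G e \<noteq> {}}" if "X \<in> ?K" for X
  proof -
    have mX: "m v \<in> ?E \<and> v \<in> ends G (m v)" if "v \<in> X" for v
      using m KV[OF \<open>X \<in> ?K\<close>] that by blast
    have "inj_on m X"
    proof (rule inj_onI)
      fix u v assume "u \<in> X" "v \<in> X" "m u = m v"
      then show "u = v" using one_end[OF _ \<open>X \<in> ?K\<close>, of "m u" u v] mX[of u] mX[of v] by simp
    qed
    moreover have "m ` X = {e\<in>?E. X \<inter> ends G e \<noteq> {}}"
    proof
      show "m ` X \<subseteq> {e\<in>?E. X \<inter> ends G e \<noteq> {}}"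
        using mX by blast
      show "{e\<in>?E. X \<inter> ends G e \<noteq> {}} \<subseteq> m ` X"
        using m_unique KV[OF that] by blast
    qed
    ultimately show ?thesis by (simp add: bij_betw_def)
  qed
  have five: "card {e\<in>?E. X \<inter> ends G e \<noteq> {}} = 5" if "X \<in> ?K" for X
    using bij_betw_same_card[OF m_bij[OF that]] pent(1)[OF that that] by simp

  \<comment> \<open>Colouring the matching edges with five colours\<close>
  have "\<exists>c::'e \<Rightarrow> nat. c ` ?E \<subseteq> {..<5} \<and>
    (\<forall>e\<in>?E. \<forall>e'\<in>?E. c e = c e' \<and> (l e = l e' \<or> r e = r e') \<longrightarrow> e = e')"
  proof (rule regular_bipartite_edge_colouring)
    show "finite A" "finite B" using \<open>finite ?K\<close> AB by (metis finite_Un)+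
    have "{e\<in>?E. l e = X} = {e\<in>?E. X \<inter> ends G e \<noteq> {}}" if "X \<in> A" for X
      using l_iff[OF _ that] by blast
    moreover have "A \<subseteq> ?K" using AB(2) by blast
    ultimately show "\<forall>X\<in>A. card {e\<in>?E. l e = X} = 5" using five by (simp add: subset_iff)
    have "{e\<in>?E. r e = X} = {e\<in>?E. X \<inter> ends G e \<noteq> {}}" if "X \<in> B" for X
      using r_iff[OF _ that] by blast
    moreover have "B \<subseteq> ?K" using AB(2) by blast
    ultimately show "\<forall>X\<in>B. card {e\<in>?E. r e = X} = 5" using five by (simp add: subset_iff)
    show "l ` ?E \<subseteq> A" "r ` ?E \<subseteq> B" using lA rB by blast+
  qed (rule fin)
  then obtain c :: "'e \<Rightarrow> nat" where c5: "c ` ?E \<subseteq> {..<5}"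
    and c: "\<And>e e'. e \<in> ?E \<Longrightarrow> e' \<in> ?E \<Longrightarrow> c e = c e' \<Longrightarrow> l e = l e' \<or> r e = r e' \<Longrightarrow> e = e'"
    by metis
  \<comment> \<open>All edges leaving \<open>X\<close> share the contracted end \<open>X\<close> on
    one side, so properness of the colouring makes their colours distinct.\<close>
  have col_inj: "inj_on (\<lambda>v. c (m v)) X" if "X \<in> ?K" for X
  proof (rule inj_onI)
    fix u v assume uv: "u \<in> X" "v \<in> X" "c (m u) = c (m v)"
    then have V: "u \<in> verts G" "v \<in> verts G" using KV[OF that] by auto
    then have mE: "m u \<in> ?E" "m v \<in> ?E" and meet: "X \<inter> ends G (m u) \<noteq> {}" "X \<inter> ends G (m v) \<noteq> {}"
      using m[OF V(1)] m[OF V(2)] uv by blast+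
    from that AB(2) consider "X \<in> A" | "X \<in> B" by blast
    then have "l (m u) = l (m v) \<or> r (m u) = r (m v)"
    proof cases
      case 1
      then show ?thesis using l_iff[OF mE(1), of X] l_iff[OF mE(2), of X] meet by simp
    next
      case 2
      then show ?thesis using r_iff[OF mE(1), of X] r_iff[OF mE(2), of X] meet by simp
    qed
    then have "m u = m v" by (rule c[OF mE uv(3)])
    then show "u = v" using m_bij[OF that] uv by (auto simp: bij_betw_def inj_on_def)
  qed
  \<comment> \<open>Five distinct colours below 5 exhaust all the colours.\<close>
  have col_surj: "\<exists>v\<in>X. c (m v) = i" if X: "X \<in> ?K" and i: "i < 5" for X i
  proof -
    have "(\<lambda>v. c (m v)) ` X \<subseteq> {..<5}"
      using c5 m KV[OF X] by (auto simp: image_subset_iff)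
    moreover have "card ((\<lambda>v. c (m v)) ` X) = 5"
      using card_image[OF col_inj[OF X]] pent(1)[OF X X] by simp
    ultimately have "(\<lambda>v. c (m v)) ` X = {..<5}"
      by (simp add: card_subset_eq)
    then show ?thesis using i by (metis imageE lessThan_iff)
  qed

  \<comment> \<open>An edge of \<open>F\<close> is put into \<open>M i\<close> when a vertex of
    colour \<open>i\<close> flanks it, that is, when it lies in the matching of its pentagon minus
    that vertex. Colours stay below 5, so index 5 is free for the complement of
    \<open>F\<close>.\<close>
  define M where "M i = (if i = 5 then ?E
      else {e\<in>?E. c e = i} \<union> {e\<in>F. i \<in> (\<lambda>v. c (m v)) ` flanking G F e})" for i

  \<comment> \<open>The six sets are perfect matchings\<close>
  have "perfect_matching G (M i)" if "i < 6" for i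
    unfolding perfect_matching_def
  proof (intro conjI ballI)
    show "M i \<subseteq> edges G" using FG by (auto simp: M_def)
    show "card (ends G e) = 2" if "e \<in> M i" for e
    proof (cases "e \<in> F")
      case True
      then show ?thesis using F_meets pent(2) by blast
    next
      case False
      then show ?thesis using that two_ends by (auto simp: M_def split: if_splits)
    qed
    fix w assume w: "w \<in> verts G"
    show "\<exists>!e. e \<in> M i \<and> w \<in> ends G e"
    proof (cases "i = 5")
      case True
      then show ?thesis using ex1_edge_outside_two_factor[OF assms(1,2,4) w] by (simp add: M_def)
    next
      case False
      then have "i < 5" using \<open>i < 6\<close> by simp
      obtain X where X: "X \<in> ?K" "w \<in> X" using comp[OF w] by blast
      \<comment> \<open>\<open>v\<close> is the one vertex of the pentagon of \<open>w\<close> that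
        is matched outward in \<open>M i\<close>; all its other vertices must be matched along the
        pentagon.\<close>
      obtain v where v: "v \<in> X" "c (m v) = i" using col_surj[OF X(1) \<open>i < 5\<close>] by blast
      have col: "c (m u) = i \<longleftrightarrow> u = v" if "u \<in> X" for u
        using col_inj[OF X(1)] v that by (auto simp: inj_on_def)
      have outer: "e \<in> M i \<and> w \<in> ends G e \<longleftrightarrow> e = m w \<and> w = v" if "e \<notin> F" for e
        using that m[OF w] m_unique[OF w] col[OF X(2)] False by (auto simp: M_def)
      \<comment> \<open>The vertices flanking \<open>e\<close> lie in \<open>X\<close>, where only
        \<open>v\<close> has colour \<open>i\<close>, so membership in \<open>M i\<close> reduces to
        being flanked by \<open>v\<close>.\<close>
      have inner: "e \<in> M i \<and> w \<in> ends G e \<longleftrightarrow> w \<in> ends G e \<and> v \<in> flanking G F e" if "e \<in> F" for e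
      proof -
        have "flanking G F e \<subseteq> X" if "w \<in> ends G e"
          using pent(3)[OF X(1) X(1) \<open>e \<in> F\<close>] that X(2) by blast
        then show ?thesis
          using that False col v by (auto simp: M_def)
      qed
      show ?thesis
      proof (cases "w = v")
        case True
        \<comment> \<open>No edge is flanked by one of its own ends, so at \<open>v\<close> only the
          outgoing edge remains.\<close>
        have "e \<in> M i \<and> w \<in> ends G e \<longleftrightarrow> e = m w" for e
          using outer[of e] inner[of e] m[OF w] True by (cases "e \<in> F") (auto simp: flanking_def)
        then show ?thesis by simp
      next
        case False
        have "e \<in> M i \<and> w \<in> ends G e \<longleftrightarrow> e \<in> F \<and> w \<in> ends G e \<and> v \<in> flanking G F e" for e
          using outer[of e] inner[of e] False by (cases "e \<in> F") auto
        then show ?thesis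
          using pent(4)[OF X(1) X(1) v(1) X(2)] False by simp
      qed
    qed
  qed

  \<comment> \<open>Every edge is covered exactly twice\<close>
  moreover have "card {i. i < 6 \<and> e \<in> M i} = 2" if e: "e \<in> edges G" for e
  proof (cases "e \<in> F")
    case True
    then obtain X where X: "X \<in> ?K" "ends G e \<inter> X \<noteq> {}" using F_meets by blast
    have fl: "flanking G F e \<subseteq> X" "card (flanking G F e) = 2"
      using pent(3)[OF X(1) X(1) True X(2)] by auto
    have "c (m v) < 5" if "v \<in> flanking G F e" for v
      using that fl KV[OF X(1)] m c5 by (auto simp: image_subset_iff subset_iff)
    \<comment> \<open>The indices are the colours of the two flanking vertices, distinct because
      both lie in one pentagon.\<close>
    then have "{i. i < 6 \<and> e \<in> M i} = (\<lambda>v. c (m v)) ` flanking G F e"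
      using True by (force simp: M_def)
    then show ?thesis
      using card_image[OF inj_on_subset[OF col_inj[OF X(1)] fl(1)]] fl(2) by simp
  next
    case False
    then have "c e < 5" using c5 e by auto
    \<comment> \<open>An edge outside \<open>F\<close> occurs once under its own colour and once in
      the complement of \<open>F\<close>.\<close>
    then have "{i. i < 6 \<and> e \<in> M i} = {5, c e}"
      using False e by (auto simp: M_def)
    then show ?thesis using \<open>c e < 5\<close> by simp
  qed
  ultimately show ?thesis
    unfolding fulkerson_covering_def by blast
qed

end
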